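(* For every integer $n\geq 3$, $\gamma_2(G_{4,n})=\left\lceil \frac{7n+3}{4}\right\rceil$.
   Context: For a graph $G$, a set $D\subseteq V(G)$ is a $2$-dominating set if every vertex not in $D$ has at least $2$ neighbours in $D$. The $2$-domination number $\gamma_2(G)$ is the minimum cardinality of a $2$-dominating set of $G$. The grid graph $G_{m,n}=P_m\times P_n$ has vertex set $[m]\times[n]$ (where $[k]=\{1,\dots,k\}$), with $(i,j)$ and $(i',j')$ adjacent iff $|i-i'|+|j-j'|=1$. *)

theory Defs
  imports Complex_Main "Graph_Theory.Pair_Digraph"
begin

text \<open>
  Graphs are finite simple graphs in the sense of the locale \<^locale>\<open>pair_graph\<close>: finite, loop-free
  digraphs with a symmetric arc relation. An undirected edge between u and v is the pair of arcs
  (u, v) and (v, u). The definitions below are meant for such graphs only; in an infinite graph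
  \<^const>\<open>card\<close> would not count correctly.
\<close>

definition two_dominating :: "'a pair_pre_digraph \<Rightarrow> 'a set \<Rightarrow> bool" where
  "two_dominating G D \<longleftrightarrow>
     D \<subseteq> pverts G \<and> (\<forall>v \<in> pverts G - D. card {u \<in> D. (v, u) \<in> parcs G} \<ge> 2)"

definition two_domination_number :: "'a pair_pre_digraph \<Rightarrow> nat" where
  "two_domination_number G = Min (card ` {D. two_dominating G D})"

text \<open>
  The distances are taken in the integers because subtraction of natural numbers truncates.
\<close>

definition grid_graph :: "nat \<Rightarrow> nat \<Rightarrow> (nat \<times> nat) pair_pre_digraph" where
  "grid_graph m n =
     \<lparr> pverts = {1..m} \<times> {1..n},
       parcs = {((i, j), (i', j')).
                  (i, j) \<in> {1..m} \<times> {1..n} \<and> (i', j') \<in> {1..m} \<times> {1..n} \<and>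
                  \<bar>int i - int i'\<bar> + \<bar>int j - int j'\<bar> = 1} \<rparr>"

lemma pair_graph_grid_graph: "pair_graph (grid_graph m n)"
proof
  show "finite (pverts (grid_graph m n))"
    by (simp add: grid_graph_def)
  have "parcs (grid_graph m n) \<subseteq> pverts (grid_graph m n) \<times> pverts (grid_graph m n)"
    by (auto simp: grid_graph_def)
  then show "finite (parcs (grid_graph m n))"
    by (rule finite_subset) (simp add: grid_graph_def)
  show "symmetric (with_proj (grid_graph m n))"
    by (auto simp: symmetric_def sym_def grid_graph_def arcs_ends_def arc_to_ends_def
        abs_minus_commute)
qed (auto simp: grid_graph_def)

lemma two_dominating_pverts: "two_dominating G (pverts G)"
  by (simp add: two_dominating_def)

lemma two_domination_number_attained:
  assumes "finite (pverts G)"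
  shows "\<exists>D. two_dominating G D \<and> card D = two_domination_number G"
    and "\<And>D. two_dominating G D \<Longrightarrow> two_domination_number G \<le> card D"
proof -
  let ?S = "{D. two_dominating G D}"
  have fin: "finite (card ` ?S)"
    using assms by (auto intro!: finite_imageI finite_subset[of ?S "Pow (pverts G)"]
        simp: two_dominating_def)
  have ne: "card ` ?S \<noteq> {}"
    using two_dominating_pverts[of G] by blast
  show "\<exists>D. two_dominating G D \<and> card D = two_domination_number G"
    using Min_in[OF fin ne] unfolding two_domination_number_def by auto
  show "two_domination_number G \<le> card D" if "two_dominating G D" for D
    using Min_le[OF fin] that unfolding two_domination_number_def by simp
qed

end

theory Submission
  imports Defs
begin

text \<open>
  For the lower bound, scan the grid column by column and charge every column four times the number
  of its chosen cells minus seven. A potential on the possible states of the last column, which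
  grows by at most the charge in every step, shows that the total charge is at least three. For the
  upper bound, a periodic pattern with density seven cells per four columns is repaired at both
  ends.
\<close>

section \<open>Grid graphs\<close>

text \<open>Since \<open>i\<close> and \<open>j\<close> are positive, truncated subtraction is exact
  and the four cells are distinct. Those off the grid are not in \<open>D\<close> and count 0, so
  the border needs no special form.\<close>

lemma two_dominating_grid_iff:
  "two_dominating (grid_graph m n) D \<longleftrightarrow>
     D \<subseteq> {1..m} \<times> {1..n} \<and>
     (\<forall>i\<in>{1..m}. \<forall>j\<in>{1..n}. (i, j) \<in> D \<or>
        (2::nat) \<le> of_bool ((i, j - 1) \<in> D) + of_bool ((i, j + 1) \<in> D) +
          of_bool ((i - 1, j) \<in> D) + of_bool ((i + 1, j) \<in> D))"
proof (cases "D \<subseteq> {1..m} \<times> {1..n}")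
  case D: True
  have count: "card {u \<in> D. ((i, j), u) \<in> parcs (grid_graph m n)} =
      of_bool ((i, j - 1) \<in> D) + of_bool ((i, j + 1) \<in> D) +
      of_bool ((i - 1, j) \<in> D) + of_bool ((i + 1, j) \<in> D)"
    if ij: "i \<in> {1..m}" "j \<in> {1..n}" for i j
  proof -
    let ?N = "{(i, j - 1), (i, j + 1), (i - 1, j), (i + 1, j)}"
    have "{u \<in> D. ((i, j), u) \<in> parcs (grid_graph m n)} = {u \<in> ?N. u \<in> D}"
      using D ij by (auto simp: grid_graph_def)
    also have "card \<dots> = (\<Sum>u\<in>?N. of_bool (u \<in> D))"
      by (simp add: sum_of_bool_eq Int_def)
    finally show ?thesis
      using ij by (auto simp: card_insert_if)
  qed
  have verts: "pverts (grid_graph m n) = {1..m} \<times> {1..n}"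
    by (simp add: grid_graph_def)
  have "two_dominating (grid_graph m n) D \<longleftrightarrow>
      (\<forall>i\<in>{1..m}. \<forall>j\<in>{1..n}. (i, j) \<in> D \<or>
        2 \<le> card {u \<in> D. ((i, j), u) \<in> parcs (grid_graph m n)})"
    using D by (auto simp: two_dominating_def verts)
  also have "\<dots> \<longleftrightarrow> (\<forall>i\<in>{1..m}. \<forall>j\<in>{1..n}. (i, j) \<in> D \<or>
        (2::nat) \<le> of_bool ((i, j - 1) \<in> D) + of_bool ((i, j + 1) \<in> D) +
          of_bool ((i - 1, j) \<in> D) + of_bool ((i + 1, j) \<in> D))"
    by (intro ball_cong refl) (simp only: count)
  finally show ?thesis
    using D by simp
next
  case False
  then show ?thesis
    by (simp add: two_dominating_def grid_graph_def)
qed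

lemma card_eq_sum_columns:
  fixes m n :: nat
  assumes "D \<subseteq> {1..m} \<times> {1..n}"
  shows "card D = (\<Sum>j=1..n. \<Sum>i=1..m. of_bool ((i, j) \<in> D))"
proof -
  have "card D = card (({1..m} \<times> {1..n}) \<inter> {u. u \<in> D})"
    using assms by (intro arg_cong[where f = card]) auto
  also have "\<dots> = (\<Sum>u\<in>{1..m} \<times> {1..n}. of_bool (u \<in> D))"
    by (subst sum_of_bool_eq) auto
  also have "\<dots> = (\<Sum>i=1..m. \<Sum>j=1..n. of_bool ((i, j) \<in> D))"
    by (simp only: sum.cartesian_product case_prod_unfold prod.collapse)
  also have "\<dots> = (\<Sum>j=1..n. \<Sum>i=1..m. of_bool ((i, j) \<in> D))"
    by (rule sum.swap)
  finally show ?thesis .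
qed

section \<open>Lower bound\<close>

text \<open>
  The status of a cell records how far its left, upper and lower neighbours dominate it. In a
  2-dominating set an open cell has exactly one chosen neighbour among these, so its right
  neighbour must be chosen.
\<close>

datatype status = Chosen | Settled | Open

definition status :: "bool \<Rightarrow> bool \<Rightarrow> bool \<Rightarrow> bool \<Rightarrow> status" where
  "status l b u d =
     (if b then Chosen else if l \<and> u \<or> l \<and> d \<or> u \<and> d then Settled else Open)"

text \<open>Every status computed from an actual column satisfies this for its vertical neighbours.
  It lets \<open>potential_step\<close> range over abstract statuses and still discard impossible
  columns.\<close>

definition consistent :: "status \<Rightarrow> bool \<Rightarrow> bool \<Rightarrow> bool" where
  "consistent s u d \<longleftrightarrow> (s = Settled \<longrightarrow> u \<or> d) \<and> (s = Open \<longrightarrow> \<not> (u \<and> d))"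

text \<open>Here \<open>c\<close> is the right neighbour of the cell with status \<open>s\<close>,
  and \<open>u\<close>, \<open>d\<close> lie above and below \<open>c\<close>. The cell to the right
  of \<open>c\<close> is still unknown but supplies at most one of the two required neighbours, so
  an unchosen \<open>c\<close> needs one among the other three.\<close>

definition extensible :: "status \<Rightarrow> bool \<Rightarrow> bool \<Rightarrow> bool \<Rightarrow> bool" where
  "extensible s c u d \<longleftrightarrow> (s = Open \<longrightarrow> c) \<and> (s = Chosen \<or> c \<or> u \<or> d)"

definition extensible_column ::
    "status \<Rightarrow> status \<Rightarrow> status \<Rightarrow> status \<Rightarrow> bool \<Rightarrow> bool \<Rightarrow> bool \<Rightarrow> bool \<Rightarrow> bool" where
  "extensible_column s1 s2 s3 s4 c1 c2 c3 c4 \<longleftrightarrow>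
     extensible s1 c1 False c2 \<and> extensible s2 c2 c1 c3 \<and>
     extensible s3 c3 c2 c4 \<and> extensible s4 c4 c3 False"

text \<open>
  The potential comes from a shortest path computation on the status columns, where appending a
  column with k chosen cells costs 4 k - 7. The corrections are listed up to reflection.
\<close>

definition correction :: "status list \<Rightarrow> int" where
  "correction s =
     (if s \<in> {[Chosen, Open, Open, Chosen], [Open, Chosen, Chosen, Open]} then 1
      else if s \<in> {[Settled, Chosen, Settled, Open], [Open, Chosen, Open, Open],
        [Chosen, Open, Open, Open], [Chosen, Settled, Open, Open]} then - 1
      else if s \<in> {[Settled, Chosen, Open, Open], [Open, Open, Open, Open]} then - 2
      else 0)"

text \<open>Falling back on \<open>rev s\<close>, instead of adding both corrections, avoids
  correcting palindromic columns twice.\<close>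

definition potential :: "status list \<Rightarrow> int" where
  "potential s = 3 - int (count_list s Open) + of_bool (3 \<le> count_list s Chosen) +
     (if correction s = 0 then correction (rev s) else correction s)"

lemma status_eq_Chosen_iff [simp]: "status l b u d = Chosen \<longleftrightarrow> b"
  by (simp add: status_def)

lemma consistent_status: "consistent (status l b u d) u d"
  by (simp add: consistent_def status_def)

lemma extensible_status:
  assumes "b \<or> (2::nat) \<le> of_bool l + of_bool r + of_bool u + of_bool d"
    and "r \<or> (2::nat) \<le> of_bool b + of_bool r' + of_bool u' + of_bool d'"
  shows "extensible (status l b u d) r u' d'"
  using assms unfolding extensible_def status_def
  by (cases l; cases b; cases r; cases u; cases d; cases u'; cases d'; cases r'; simp)

text \<open>Every column listed in \<open>correction\<close> has an \<open>Open\<close> cell, so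
  here only the constant 3 and a nonnegative bonus remain.\<close>

lemma potential_final:
  assumes "s1 \<noteq> Open" "s2 \<noteq> Open" "s3 \<noteq> Open" "s4 \<noteq> Open"
  shows "3 \<le> potential [s1, s2, s3, s4]"
  using assms by (cases s1; cases s2; cases s3; cases s4; simp add: potential_def correction_def)

text \<open>
  The next two lemmas are stated with object-level implications so that after the case distinction
  the simplifier discards the many inadmissible cases quickly.
\<close>

lemma potential_step:
  "consistent s1 False (s2 = Chosen) \<and> consistent s2 (s1 = Chosen) (s3 = Chosen) \<and>
   consistent s3 (s2 = Chosen) (s4 = Chosen) \<and> consistent s4 (s3 = Chosen) False \<and>
   extensible_column s1 s2 s3 s4 c1 c2 c3 c4 \<longrightarrow>
   potential [status (s1 = Chosen) c1 False c2, status (s2 = Chosen) c2 c1 c3,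
     status (s3 = Chosen) c3 c2 c4, status (s4 = Chosen) c4 c3 False]
   \<le> potential [s1, s2, s3, s4] + 4 * (of_bool c1 + of_bool c2 + of_bool c3 + of_bool c4) - 7"
  apply (cases s1; cases s2; cases s3; cases s4; simp add: consistent_def)
  apply (cases c1; cases c2; cases c3; cases c4; simp add: extensible_column_def extensible_def;
      simp add: status_def potential_def correction_def)+
  done

text \<open>
  The grid with two columns has a 2-dominating set with four elements, one below the formula.
  Hence the potential bounds the total charge only from the third column on.
\<close>

lemma potential_initial:
  "extensible_column Settled Settled Settled Settled a1 a2 a3 a4 \<and>
   extensible_column (status False a1 False a2) (status False a2 a1 a3)
     (status False a3 a2 a4) (status False a4 a3 False) b1 b2 b3 b4 \<and>
   extensible_column (status a1 b1 False b2) (status a2 b2 b1 b3)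
     (status a3 b3 b2 b4) (status a4 b4 b3 False) c1 c2 c3 c4 \<longrightarrow>
   potential [status b1 c1 False c2, status b2 c2 c1 c3, status b3 c3 c2 c4, status b4 c4 c3 False]
   \<le> 4 * (of_bool a1 + of_bool a2 + of_bool a3 + of_bool a4) +
     4 * (of_bool b1 + of_bool b2 + of_bool b3 + of_bool b4) +
     4 * (of_bool c1 + of_bool c2 + of_bool c3 + of_bool c4) - 21"
  apply (cases a1; cases a2; cases a3; cases a4;
      simp add: status_def extensible_column_def extensible_def)
  apply (cases b1; cases b2; cases b3; cases b4; simp;
      cases c1; cases c2; cases c3; cases c4; simp;
      simp add: status_def potential_def correction_def)+
  done

lemma grid_4_lower_bound:
  assumes dom: "two_dominating (grid_graph 4 n) D" and n: "3 \<le> n"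
  shows "7 * n + 3 \<le> 4 * card D"
proof -
  have D: "D \<subseteq> {1..4} \<times> {1..n}"
    and nbrs: "\<And>i j. i \<in> {1..4} \<Longrightarrow> j \<in> {1..n} \<Longrightarrow> (i, j) \<in> D \<or>
        (2::nat) \<le> of_bool ((i, j - 1) \<in> D) + of_bool ((i, j + 1) \<in> D) +
          of_bool ((i - 1, j) \<in> D) + of_bool ((i + 1, j) \<in> D)"
    using dom unfolding two_dominating_grid_iff by blast+
  define x where "x i j \<longleftrightarrow> (i, j) \<in> D" for i j
  define st where "st i j = status (x i (j - 1)) (x i j) (x (i - 1) j) (x (i + 1) j)" for i j
  define w :: "nat \<Rightarrow> int" where
    "w j = of_bool (x 1 j) + of_bool (x 2 j) + of_bool (x 3 j) + of_bool (x 4 j)" for j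
  have outside [simp]: "\<not> x 0 j" "\<not> x 5 j" "\<not> x i 0" "\<not> x i (Suc n)" for i j
    using D by (auto simp: x_def)
  have two: "x i j \<or> (2::nat) \<le> of_bool (x i (j - 1)) + of_bool (x i (j + 1)) +
      of_bool (x (i - 1) j) + of_bool (x (i + 1) j)" if "i \<in> {1..4}" "j \<in> {1..n}" for i j
    using nbrs[OF that] by (simp add: x_def)
  have rows: "st 1 j = status (x 1 (j - 1)) (x 1 j) False (x 2 j)"
      "st 2 j = status (x 2 (j - 1)) (x 2 j) (x 1 j) (x 3 j)"
      "st 3 j = status (x 3 (j - 1)) (x 3 j) (x 2 j) (x 4 j)"
      "st 4 j = status (x 4 (j - 1)) (x 4 j) (x 3 j) False" for j
    using outside by (simp_all add: st_def numeral_eq_Suc)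
  have st_ext: "extensible (st i j) (x i (j + 1)) (x (i - 1) (j + 1)) (x (i + 1) (j + 1))"
    if "i \<in> {1..4}" "j \<in> {1..<n}" for i j
    unfolding st_def
    \<comment> \<open>\<open>r'\<close> is absent from the conclusion of the rule; it is the cell
      two columns to the right, possibly off the grid.\<close>
    by (rule extensible_status[where r' = "x i (j + 2)"])
      (use two[of i j] two[of i "j + 1"] that in auto)
  have column_ext: "extensible_column (st 1 j) (st 2 j) (st 3 j) (st 4 j)
      (x 1 (j + 1)) (x 2 (j + 1)) (x 3 (j + 1)) (x 4 (j + 1))" if "j \<in> {1..<n}" for j
    using st_ext[of 1 j] st_ext[of 2 j] st_ext[of 3 j] st_ext[of 4 j] outside that
    by (simp add: extensible_column_def numeral_eq_Suc)
  have bound: "potential [st 1 j, st 2 j, st 3 j, st 4 j] \<le> 4 * (\<Sum>k=1..j. w k) - 7 * int j"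
    if "3 \<le> j" "j \<le> n" for j
    using that
  proof (induction j rule: dec_induct)
    case base
    \<comment> \<open>A virtual column 0: \<open>Settled\<close> cells neither dominate column 1 nor
      demand anything of it.\<close>
    have "extensible_column Settled Settled Settled Settled (x 1 1) (x 2 1) (x 3 1) (x 4 1)"
      using two[of 1 1] two[of 2 1] two[of 3 1] two[of 4 1] outside n
      by (auto simp: extensible_column_def extensible_def numeral_eq_Suc of_bool_def
          split: if_splits)
    moreover have "extensible_column (status False (x 1 1) False (x 2 1))
        (status False (x 2 1) (x 1 1) (x 3 1)) (status False (x 3 1) (x 2 1) (x 4 1))
        (status False (x 4 1) (x 3 1) False) (x 1 2) (x 2 2) (x 3 2) (x 4 2)"
      using column_ext[of 1] n by (simp add: rows del: One_nat_def)
    moreover have "extensible_column (status (x 1 1) (x 1 2) False (x 2 2))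
        (status (x 2 1) (x 2 2) (x 1 2) (x 3 2)) (status (x 3 1) (x 3 2) (x 2 2) (x 4 2))
        (status (x 4 1) (x 4 2) (x 3 2) False) (x 1 3) (x 2 3) (x 3 3) (x 4 3)"
      using column_ext[of 2] rows[of 2] n by simp
    ultimately have "potential [status (x 1 2) (x 1 3) False (x 2 3),
        status (x 2 2) (x 2 3) (x 1 3) (x 3 3), status (x 3 2) (x 3 3) (x 2 3) (x 4 3),
        status (x 4 2) (x 4 3) (x 3 3) False] \<le> 4 * w 1 + 4 * w 2 + 4 * w 3 - 21"
      unfolding w_def by (intro potential_initial[THEN mp] conjI)
    moreover have "{1..3::nat} = {1, 2, 3}"
      by auto
    ultimately show ?case
      by (simp add: rows distrib_left del: One_nat_def)
  next
    case (step j)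
    have chosen: "st i j = Chosen \<longleftrightarrow> x i j" for i
      by (simp add: st_def)
    have "consistent (st 1 j) False (st 2 j = Chosen)"
        "consistent (st 2 j) (st 1 j = Chosen) (st 3 j = Chosen)"
        "consistent (st 3 j) (st 2 j = Chosen) (st 4 j = Chosen)"
        "consistent (st 4 j) (st 3 j = Chosen) False"
      unfolding chosen by (simp_all only: rows consistent_status)
    moreover have "extensible_column (st 1 j) (st 2 j) (st 3 j) (st 4 j)
        (x 1 (Suc j)) (x 2 (Suc j)) (x 3 (Suc j)) (x 4 (Suc j))"
      using column_ext[of j] step.hyps step.prems by simp
    ultimately have "potential [status (st 1 j = Chosen) (x 1 (Suc j)) False (x 2 (Suc j)),
        status (st 2 j = Chosen) (x 2 (Suc j)) (x 1 (Suc j)) (x 3 (Suc j)),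
        status (st 3 j = Chosen) (x 3 (Suc j)) (x 2 (Suc j)) (x 4 (Suc j)),
        status (st 4 j = Chosen) (x 4 (Suc j)) (x 3 (Suc j)) False]
        \<le> potential [st 1 j, st 2 j, st 3 j, st 4 j] + 4 * w (Suc j) - 7"
      unfolding w_def by (intro potential_step[THEN mp] conjI)
    then have "potential [st 1 (Suc j), st 2 (Suc j), st 3 (Suc j), st 4 (Suc j)]
        \<le> potential [st 1 j, st 2 j, st 3 j, st 4 j] + 4 * w (Suc j) - 7"
      by (simp only: rows[of "Suc j"] chosen diff_Suc_1)
    with step show ?case
      by simp
  qed
  \<comment> \<open>Column \<open>n + 1\<close> is empty, so an unchosen cell of column
    \<open>n\<close> has two chosen neighbours to the left, above or below.\<close>
  have "st i n \<noteq> Open" if "i \<in> {1..4}" for i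
    using two[of i n] that n unfolding st_def status_def
    by (auto simp: of_bool_def split: if_splits)
  then have "3 \<le> potential [st 1 n, st 2 n, st 3 n, st 4 n]"
    by (intro potential_final) auto
  also have "\<dots> \<le> 4 * (\<Sum>k=1..n. w k) - 7 * int n"
    using bound n by simp
  also have "(\<Sum>k=1..n. w k) = int (card D)"
  proof -
    have "{1..4::nat} = {1, 2, 3, 4}"
      by auto
    then show ?thesis
      by (simp add: card_eq_sum_columns[OF D] w_def x_def add.assoc del: sum_of_bool_eq)
  qed
  finally show ?thesis
    by simp
qed

section \<open>Upper bound\<close>

text \<open>
  An eight-periodic pattern with seven cells in every four columns; only the first and the last
  column need a repair.
\<close>

definition grid_4_pattern :: "(nat \<times> nat) set" where
  "grid_4_pattern = {(i, j). i \<in> {1, 4} \<and> even j \<or> i = 2 \<and> j mod 8 \<in> {0, 3, 5} \<or>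
     i = 3 \<and> j mod 8 \<in> {1, 4, 7}}"

text \<open>In the pattern, \<open>(1, 1)\<close> and \<open>(2, 1)\<close> each have just one
  chosen neighbour; adding \<open>(2, 1)\<close> repairs both. At the right end the row depends on
  \<open>n mod 8\<close>: shifting the pattern by 4 columns swaps rows 2 and 3.\<close>

definition grid_4_witness :: "nat \<Rightarrow> (nat \<times> nat) set" where
  "grid_4_witness n = grid_4_pattern \<inter> {1..4} \<times> {1..n} \<union>
     {(2, 1), (if n mod 8 \<in> {0, 1, 2, 7} then 2 else 3, n)}"

lemma even_iff_mod_8: "even j \<longleftrightarrow> j mod 8 \<in> {0, 2, 4, 6}" for j :: nat
  by (simp, presburger)

lemma two_dominating_grid_4_witness:
  assumes "3 \<le> n"
  shows "two_dominating (grid_graph 4 n) (grid_4_witness n)"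
  unfolding two_dominating_grid_iff
proof (intro conjI ballI)
  show "grid_4_witness n \<subseteq> {1..4} \<times> {1..n}"
    using assms by (auto simp: grid_4_witness_def)
next
  fix i j assume ij: "i \<in> {1..4::nat}" "j \<in> {1..n}"
  let ?D = "grid_4_witness n"
  \<comment> \<open>With columns \<open>k\<close>, \<open>k + 1\<close>, \<open>k + 2\<close> in
    place of \<open>j - 1\<close>, \<open>j\<close>, \<open>j + 1\<close>, \<open>mod_Suc\<close>
    derives all residues from \<open>k mod 8\<close>.\<close>
  obtain k where k: "j = Suc k"
    using ij by (cases j) auto
  have i: "i = 1 \<or> i = 2 \<or> i = 3 \<or> i = 4"
    using ij by auto
  have "k mod 8 < 8"
    by simp
  then have r: "k mod 8 = 0 \<or> k mod 8 = 1 \<or> k mod 8 = 2 \<or> k mod 8 = 3 \<or>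
      k mod 8 = 4 \<or> k mod 8 = 5 \<or> k mod 8 = 6 \<or> k mod 8 = 7"
    by linarith
  consider "k = 0" | "0 < k" "j < n" | "0 < k" "j = n"
    using ij by force
  then show "(i, j) \<in> ?D \<or> (2::nat) \<le> of_bool ((i, j - 1) \<in> ?D) + of_bool ((i, j + 1) \<in> ?D) +
      of_bool ((i - 1, j) \<in> ?D) + of_bool ((i + 1, j) \<in> ?D)"
  proof cases
    case 1
    with i k assms show ?thesis
      by (auto simp: grid_4_witness_def grid_4_pattern_def)
  next
    case 2
    with i r k show ?thesis
      by (elim disjE; simp add: grid_4_witness_def grid_4_pattern_def even_iff_mod_8 mod_Suc)
  next
    case 3
    with i r k show ?thesis
      by (elim disjE; simp add: grid_4_witness_def grid_4_pattern_def even_iff_mod_8 mod_Suc)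
  qed
qed

text \<open>Columns with residues 1, 2, 3, 0 modulo 4 hold 1, 2, 1, 3 cells; the list contains the
  partial sums.\<close>

lemma card_grid_4_pattern:
  "card (grid_4_pattern \<inter> {1..4} \<times> {1..n}) = 7 * (n div 4) + [0, 1, 3, 4] ! (n mod 4)"
proof (induction n)
  case (Suc n)
  have 4: "{1..4::nat} = {1, 2, 3, 4}"
    by auto
  have "n mod 8 < 8"
    by simp
  then have r: "n mod 8 = 0 \<or> n mod 8 = 1 \<or> n mod 8 = 2 \<or> n mod 8 = 3 \<or>
      n mod 8 = 4 \<or> n mod 8 = 5 \<or> n mod 8 = 6 \<or> n mod 8 = 7"
    by linarith
  have m: "n mod 4 = n mod 8 mod 4"
    by (simp add: mod_mod_cancel)
  have card: "card (grid_4_pattern \<inter> {1..4} \<times> {1..k}) =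
      (\<Sum>j=1..k. \<Sum>i=1..4. of_bool ((i, j) \<in> grid_4_pattern))" for k
    by (subst card_eq_sum_columns[of _ 4 k]) (auto intro!: sum.cong)
  have "card (grid_4_pattern \<inter> {1..4} \<times> {1..Suc n}) =
      card (grid_4_pattern \<inter> {1..4} \<times> {1..n}) +
      (\<Sum>i=1..4. of_bool ((i, Suc n) \<in> grid_4_pattern))"
    unfolding card by simp
  also have "(\<Sum>i=1..4. of_bool ((i, Suc n) \<in> grid_4_pattern)) = [1, 2, 1, 3] ! (n mod 4)"
    using r unfolding m 4
    by (elim disjE; simp add: grid_4_pattern_def even_iff_mod_8 mod_Suc)
  finally show ?case
    using r unfolding Suc.IH by (elim disjE; simp add: m mod_Suc div_Suc)
qed simp

text \<open>As 7 n + 6 < (7 n + 3) + 4, this bound leaves no integer above the ceiling.\<close>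

lemma card_grid_4_witness:
  assumes "3 \<le> n"
  shows "4 * card (grid_4_witness n) \<le> 7 * n + 6"
proof -
  let ?P = "grid_4_pattern \<inter> {1..4} \<times> {1..n}"
  let ?e = "(if n mod 8 \<in> {0, 1, 2, 7} then 2 else 3 :: nat, n)"
  have W: "grid_4_witness n = insert (2, 1) (insert ?e ?P)"
    by (auto simp: grid_4_witness_def)
  have fin: "finite ?P"
    by auto
  have "card (grid_4_witness n) \<le> card ?P + 1 + of_bool (?e \<notin> ?P)"
    unfolding W using fin by (simp add: card_insert_if)
  \<comment> \<open>Two extra cells would break the bound when 4 divides \<open>n\<close>; there the
    end cell is already in the pattern and costs nothing.\<close>
  moreover have "?e \<in> ?P" if "n mod 4 = 0"
  proof -
    have "n mod 8 = 0 \<or> n mod 8 = 4"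
      using that by presburger
    then show ?thesis
      using assms by (auto simp: grid_4_pattern_def)
  qed
  moreover have "n mod 4 = 0 \<or> n mod 4 = 1 \<or> n mod 4 = 2 \<or> n mod 4 = 3"
    by presburger
  moreover have "int n = 4 * int (n div 4) + int (n mod 4)"
    by presburger
  ultimately show ?thesis
    unfolding card_grid_4_pattern by (elim disjE) (auto simp: of_bool_def split: if_splits)
qed

theorem theorem4:
  fixes n :: nat
  assumes "n \<ge> 3"
  shows "int (two_domination_number (grid_graph 4 n)) = \<lceil>(7 * real n + 3) / 4\<rceil>"
proof -
  let ?G = "grid_graph 4 n"
  have fin: "finite (pverts ?G)"
    by (simp add: grid_graph_def)
  obtain D where D: "two_dominating ?G D" "card D = two_domination_number ?G"
    using two_domination_number_attained(1)[OF fin] by blast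
  have "7 * n + 3 \<le> 4 * two_domination_number ?G"
    using grid_4_lower_bound[OF D(1) assms] D(2) by simp
  then have lower: "real (7 * n + 3) \<le> real (4 * two_domination_number ?G)"
    by (simp only: of_nat_le_iff)
  have "4 * two_domination_number ?G \<le> 7 * n + 6"
    using two_domination_number_attained(2)[OF fin two_dominating_grid_4_witness[OF assms]]
      card_grid_4_witness[OF assms] by linarith
  then have upper: "real (4 * two_domination_number ?G) \<le> real (7 * n + 6)"
    by (simp only: of_nat_le_iff)
  show ?thesis
    using lower upper by (intro ceiling_unique[symmetric]) simp_all
qed

end
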